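(* Let $r\ge 2$, $n=2^r$, $M=2^{n-r}$, $\nu=2^{r-1}-1$. (1) If $\mathcal{C}$ is a zeroed NP1CC of length $n$ of Type A, or a zeroed NP1CC of length $n$ of Type C containing a codeword of weight one, then $A_0(\mathcal{C})=A_n(\mathcal{C})=1$; for other even $i$, $$A_i(\mathcal{C})=\alpha_i+\alpha_{i-1}=\frac{\binom{n}{i}+(n-1)(\Delta_{i-1}+\Delta_i)}{n};$$ and for odd $i$, $1\le i\le n-1$, $A_i(\mathcal{C})=\frac1n\binom{n}{i}$. (2) If $\mathcal{C}$ is a non-zeroed NP1CC of length $n$ of Type A, or a non-zeroed NP1CC of length $n$ of Type B or Type C that contains exactly one codeword of weight one, then $A_0(\mathcal{C})=A_n(\mathcal{C})=0$; for even $i$ with $1<i<n-1$, $$A_i(\mathcal{C})=\beta_i+\beta_{i-1}=\frac{\binom{n}{i}-(\Delta_{i-1}+\Delta_i)}{n};$$ and for odd $i$, $1\le i\le n-1$, $A_i(\mathcal{C})=\frac1n\binom{n}{i}$.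
   Context: All codes are binary; $A_i(\mathcal{C})$ is the number of codewords of $\mathcal{C}$ of Hamming weight $i$. A code is zeroed if it contains the all-zero word, non-zeroed otherwise. An NP1CC (nearly perfect 1-covering code) of length $n=2^r$ is a code $\mathcal{C}\subseteq\mathbb{F}_2^n$ with $|\mathcal{C}|=2^{n-r}$ such that every word of $\mathbb{F}_2^n$ is at distance at most $1$ from some codeword. In an NP1CC every codeword $\mathbf{c}$ has exactly one other codeword $\mathbf{c}'$ (its partner) with $d(\mathbf{c},\mathbf{c}')\in\{1,2\}$. The NP1CC is of Type A if every codeword's partner is at distance $1$, of Type B if every codeword's partner is at distance $2$, and of Type C otherwise. For integers $i\ge0$: $\Delta_i=\binom{\nu}{\lfloor i/2\rfloor}$ if $i\equiv 0,3\pmod 4$, $\Delta_i=-\binom{\nu}{\lfloor i/2\rfloor}$ if $i\equiv 1,2\pmod 4$ (with $\binom{a}{b}=0$ for $b>a$); $\alpha_i=\frac{\binom{n-1}{i}+(n-1)\Delta_i}{n}$, $\beta_i=\frac{\binom{n-1}{i}-\Delta_i}{n}$. *)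

theory Defs
  imports "HOL-Analysis.Finite_Cartesian_Product" "HOL-Library.Z2"
begin

text \<open>
  Binary words of length \<open>n\<close> are vectors over the two-element field, indexed by a finite type
  with \<open>n\<close> elements.
\<close>

type_synonym 'n word = "bit ^ 'n"

definition hamming_dist :: "'n::finite word \<Rightarrow> 'n word \<Rightarrow> nat" where
  "hamming_dist x y = card {j. x $ j \<noteq> y $ j}"

definition hamming_weight :: "'n::finite word \<Rightarrow> nat" where
  "hamming_weight x = card {j. x $ j \<noteq> 0}"

definition weight_count :: "'n::finite word set \<Rightarrow> nat \<Rightarrow> nat" where
  "weight_count C i = card {c \<in> C. hamming_weight c = i}"

definition zeroed :: "'n::finite word set \<Rightarrow> bool" where
  "zeroed C \<longleftrightarrow> 0 \<in> C"

definition np1cc :: "nat \<Rightarrow> 'n::finite word set \<Rightarrow> bool" where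
  "np1cc r C \<longleftrightarrow>
     CARD('n) = 2 ^ r \<and>
     card C = 2 ^ (CARD('n) - r) \<and>
     (\<forall>x. \<exists>c\<in>C. hamming_dist x c \<le> 1)"

definition is_partner :: "'n::finite word set \<Rightarrow> 'n word \<Rightarrow> 'n word \<Rightarrow> bool" where
  "is_partner C c c' \<longleftrightarrow> c' \<in> C \<and> c' \<noteq> c \<and> hamming_dist c c' \<in> {1, 2}"

text \<open>
  In an NP1CC every codeword has exactly one partner, so quantifying over all partners of a
  codeword is the same as referring to its unique partner. The three types are only meaningful
  for NP1CCs.
\<close>

definition type_A :: "'n::finite word set \<Rightarrow> bool" where
  "type_A C \<longleftrightarrow> (\<forall>c\<in>C. \<forall>c'. is_partner C c c' \<longrightarrow> hamming_dist c c' = 1)"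

definition type_B :: "'n::finite word set \<Rightarrow> bool" where
  "type_B C \<longleftrightarrow> (\<forall>c\<in>C. \<forall>c'. is_partner C c c' \<longrightarrow> hamming_dist c c' = 2)"

definition type_C :: "'n::finite word set \<Rightarrow> bool" where
  "type_C C \<longleftrightarrow> \<not> type_A C \<and> \<not> type_B C"

definition Delta :: "nat \<Rightarrow> nat \<Rightarrow> real" where
  "Delta \<nu> i = (if i mod 4 \<in> {0, 3} then real (\<nu> choose (i div 2))
                 else - real (\<nu> choose (i div 2)))"

definition alpha :: "nat \<Rightarrow> nat \<Rightarrow> nat \<Rightarrow> real" where
  "alpha n \<nu> i = (real ((n - 1) choose i) + (real n - 1) * Delta \<nu> i) / real n"

definition beta :: "nat \<Rightarrow> nat \<Rightarrow> nat \<Rightarrow> real" where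
  "beta n \<nu> i = (real ((n - 1) choose i) - Delta \<nu> i) / real n"

end

theory Submission imports Defs "HOL-Computational_Algebra.Primes" begin

text \<open>
  Let \<open>f\<close> be the indicator of the code, let \<open>S\<close> sum a function over balls of radius 1, and let
  \<open>e = S f - 1 \<ge> 0\<close> be the excess. As \<open>n\<close> is even, \<open>S e\<close> is odd off the code and even on it.
  The size of the code is extremal in van Wee's counting argument, so \<open>e\<close> takes only the values 0
  and 1 and \<open>S e = 1\<close> off the code. On the code \<open>S e\<close> is 2 on average, and it never vanishes
  because the words at distance 2 from a codeword with \<open>S e = 0\<close> would have to be covered by
  \<open>n\<^sup>2 / 6\<close> codewords at distance 3. Hence \<open>S f = 1 + e\<close> and \<open>S e = 1 + f\<close>. Either set of hypotheses
  amounts to \<open>e 0 = f 0\<close>; then \<open>e\<close> and \<open>f\<close> have the same weight distribution, which satisfies a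
  two-step recurrence with a closed-form solution.
\<close>

section \<open>Binary words, unit words and Hamming weight\<close>

lemma UNIV_bit: "(UNIV :: bit set) = {0, 1}"
  by auto

text \<open>Makes words a finite type, so that sums over all words are genuine finite sums.\<close>

instance bit :: finite
  by standard (unfold UNIV_bit, intro finite.intros)

lemma card_bit: "CARD(bit) = 2"
  by (subst UNIV_bit) simp

abbreviation unit_word :: "'n::finite \<Rightarrow> 'n word" where
  "unit_word i \<equiv> axis i 1"

text \<open>The adjacency operator of the hypercube. Values are integers because later arguments
  subtract and argue by parity.\<close>

definition nbr_sum :: "('n::finite word \<Rightarrow> int) \<Rightarrow> 'n word \<Rightarrow> int" where
  "nbr_sum F x = (\<Sum>i\<in>UNIV. F (x + unit_word i))"

definition ball_sum :: "('n::finite word \<Rightarrow> int) \<Rightarrow> 'n word \<Rightarrow> int" where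
  "ball_sum F x = F x + nbr_sum F x"

definition shell_sum :: "('n::finite word \<Rightarrow> int) \<Rightarrow> nat \<Rightarrow> int" where
  "shell_sum F k = (\<Sum>x | hamming_weight x = k. F x)"

lemma word_add_self [simp]: "x + x = (0 :: 'n::finite word)"
  by (simp add: vec_eq_iff)

lemma word_add_cancel [simp]: "x + y + y = (x :: 'n::finite word)"
  by (simp add: add.assoc)

lemma bij_word_add: "bij (\<lambda>x :: 'n::finite word. x + a)"
  by (rule involuntory_imp_bij) simp

lemma unit_word_nth: "unit_word i $ j = (if j = i then 1 else 0)"
  by (simp add: axis_def)

lemma unit_word_inj [simp]: "unit_word i = unit_word j \<longleftrightarrow> i = j"
  by (auto simp: axis_eq_axis)

lemma hamming_dist_weight: "hamming_dist x y = hamming_weight (x + y)"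
proof -
  have "x $ j \<noteq> y $ j \<longleftrightarrow> (x + y) $ j \<noteq> 0" for j
    by (cases "x $ j"; cases "y $ j") auto
  then show ?thesis by (simp add: hamming_dist_def hamming_weight_def)
qed

lemma hamming_weight_add_unit:
  "hamming_weight (x + unit_word i) =
     (if x $ i = 0 then Suc (hamming_weight x) else hamming_weight x - 1)"
proof (cases "x $ i = 0")
  case True
  have "{j. (x + unit_word i) $ j \<noteq> 0} = insert i {j. x $ j \<noteq> 0}"
    using True by (auto simp: unit_word_nth)
  then show ?thesis using True by (simp add: hamming_weight_def del: vector_add_component)
next
  case False
  have "{j. (x + unit_word i) $ j \<noteq> 0} = {j. x $ j \<noteq> 0} - {i}"
    using False by (auto simp: unit_word_nth)
  then show ?thesis using False by (simp add: hamming_weight_def del: vector_add_component)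
qed

lemma hamming_weight_eq_0 [simp]: "hamming_weight x = 0 \<longleftrightarrow> x = 0"
  by (auto simp: hamming_weight_def vec_eq_iff)

lemma hamming_weight_unit [simp]: "hamming_weight (unit_word i) = 1"
  using hamming_weight_add_unit[of 0 i] hamming_weight_eq_0[of 0] by simp

lemma hamming_weight_eq_1: "hamming_weight x = 1 \<longleftrightarrow> (\<exists>i. x = unit_word i)"
proof
  assume "hamming_weight x = 1"
  then obtain i where i: "{j. x $ j \<noteq> 0} = {i}"
    unfolding hamming_weight_def by (rule card_1_singletonE)
  have "x $ j \<noteq> 0 \<longleftrightarrow> j = i" for j
    using i by blast
  then have "x = unit_word i"
    unfolding vec_eq_iff unit_word_nth by (metis bit_not_zero_iff)
  then show "\<exists>i. x = unit_word i" ..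
qed auto

lemma hamming_weight_le: "hamming_weight (x :: 'n::finite word) \<le> CARD('n)"
  by (simp add: hamming_weight_def card_mono)

text \<open>A nonzero coordinate forces positive weight, so the truncated predecessor never bites
  and can be replaced by a condition on successors.\<close>

lemma hamming_weight_add_unit_eq:
  "hamming_weight (x + unit_word i) = k \<longleftrightarrow>
     x $ i = 0 \<and> Suc (hamming_weight x) = k \<or> x $ i \<noteq> 0 \<and> hamming_weight x = Suc k"
proof -
  have "hamming_weight x > 0" if "x $ i \<noteq> 0"
    using that by (metis gr0I hamming_weight_eq_0 zero_index)
  then show ?thesis by (auto simp: hamming_weight_add_unit)
qed

lemma card_nbrs_of_weight:
  "card {i. hamming_weight (x + unit_word i :: 'n::finite word) = k} =
     (if Suc (hamming_weight x) = k then CARD('n) - hamming_weight x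
      else if hamming_weight x = Suc k then Suc k else 0)"
proof -
  have "{i. x $ i = 0} = UNIV - {i. x $ i \<noteq> 0}" by auto
  then have "card {i. x $ i = 0} = CARD('n) - hamming_weight x"
    unfolding hamming_weight_def by (metis card_Diff_subset finite subset_UNIV)
  moreover have "card {i. x $ i \<noteq> 0} = hamming_weight x"
    by (simp add: hamming_weight_def)
  ultimately show ?thesis
    unfolding hamming_weight_add_unit_eq by (auto simp del: bit_not_zero_iff)
qed

section \<open>Ball sums and shell sums\<close>

text \<open>Adjacency is symmetric: translation by a unit word is an involution, so each summand can
  be reindexed by it.\<close>

lemma sum_nbr_sum_mult:
  "(\<Sum>x\<in>UNIV. F x * nbr_sum G x) = (\<Sum>x\<in>UNIV. nbr_sum F x * G x)"
proof -
  have "(\<Sum>x\<in>UNIV. F x * nbr_sum G x) = (\<Sum>i\<in>UNIV. \<Sum>x\<in>UNIV. F x * G (x + unit_word i))"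
    unfolding nbr_sum_def sum_distrib_left by (rule sum.swap)
  also have "\<dots> = (\<Sum>i\<in>UNIV. \<Sum>x\<in>UNIV. F (x + unit_word i) * G x)"
  proof (rule sum.cong[OF refl])
    fix i :: 'a
    show "(\<Sum>x\<in>UNIV. F x * G (x + unit_word i)) = (\<Sum>x\<in>UNIV. F (x + unit_word i) * G x)"
      using sum.reindex_bij_betw[OF bij_word_add[of "unit_word i"],
          of "\<lambda>x. F x * G (x + unit_word i)"]
      by simp
  qed
  also have "\<dots> = (\<Sum>x\<in>UNIV. nbr_sum F x * G x)"
    unfolding nbr_sum_def sum_distrib_right by (rule sum.swap)
  finally show ?thesis .
qed

lemma sum_ball_sum_mult:
  "(\<Sum>x\<in>UNIV. F x * ball_sum G x) = (\<Sum>x\<in>UNIV. ball_sum F x * G x)"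
  unfolding ball_sum_def distrib_left distrib_right sum.distrib sum_nbr_sum_mult ..

lemma shell_sum_alt: "shell_sum F k = (\<Sum>x\<in>UNIV. of_bool (hamming_weight x = k) * F x)"
  unfolding shell_sum_def by (rule sum.mono_neutral_cong_left) auto

text \<open>Symmetry moves the adjacency operator from \<open>F\<close> to the indicator of the
  shell, where it counts neighbours.\<close>

lemma shell_sum_nbr_sum:
  "shell_sum (nbr_sum F) k =
     (\<Sum>x\<in>UNIV. int (card {i. hamming_weight (x + unit_word i) = k}) * F (x :: 'n::finite word))"
proof -
  have "nbr_sum (\<lambda>x. of_bool (hamming_weight x = k)) x =
      int (card {i. hamming_weight (x + unit_word i) = k})" for x :: "'n word"
    unfolding nbr_sum_def by simp
  then show ?thesis
    unfolding shell_sum_alt by (subst sum_nbr_sum_mult) simp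
qed

lemma shell_sum_nbr_sum_0: "shell_sum (nbr_sum F) 0 = shell_sum F 1"
  unfolding shell_sum_nbr_sum unfolding shell_sum_alt
  by (intro sum.cong refl, unfold card_nbrs_of_weight) auto

text \<open>A word of weight \<open>k\<close> has \<open>n - k\<close> neighbours one level up, and
  a word of weight \<open>k + 2\<close> has \<open>k + 2\<close> neighbours one level down. This is
  the source of all two-step recurrences below.\<close>

lemma shell_sum_nbr_sum_Suc:
  fixes F :: "'n::finite word \<Rightarrow> int"
  shows "shell_sum (nbr_sum F) (Suc k) =
    (int CARD('n) - int k) * shell_sum F k + (int k + 2) * shell_sum F (k + 2)"
  unfolding shell_sum_nbr_sum unfolding shell_sum_alt sum_distrib_left sum.distrib[symmetric]
proof (intro sum.cong refl)
  fix x :: "'n word"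
  show "int (card {i. hamming_weight (x + unit_word i) = Suc k}) * F x =
    (int CARD('n) - int k) * (of_bool (hamming_weight x = k) * F x) +
    (int k + 2) * (of_bool (hamming_weight x = k + 2) * F x)"
  proof (cases "hamming_weight x = k")
    case True
    then show ?thesis
      using hamming_weight_le[of x] by (simp add: card_nbrs_of_weight of_nat_diff)
  next
    case False
    then show ?thesis
      by (cases "hamming_weight x = k + 2") (simp_all add: card_nbrs_of_weight)
  qed
qed

lemma shell_sum_0 [simp]: "shell_sum F 0 = F 0"
  by (simp add: shell_sum_def)

lemma shell_sum_add: "shell_sum (\<lambda>x. F x + G x) k = shell_sum F k + shell_sum G k"
  by (simp add: shell_sum_def sum.distrib)

lemma shell_sum_1:
  "shell_sum (\<lambda>x :: 'n::finite word. 1) k = int (CARD('n) choose k)"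
proof -
  have "bij_betw (\<lambda>x. {j. x $ j \<noteq> 0}) {x :: 'n word. hamming_weight x = k}
      {A. A \<subseteq> UNIV \<and> card A = k}"
    by (rule bij_betw_byWitness[where f' = "\<lambda>A. \<chi> j. of_bool (j \<in> A)"])
       (auto simp: hamming_weight_def vec_eq_iff)
  then have "card {x :: 'n word. hamming_weight x = k} = card {A :: 'n set. A \<subseteq> UNIV \<and> card A = k}"
    by (rule bij_betw_same_card)
  then show ?thesis by (simp add: shell_sum_def n_subsets[of "UNIV :: 'n set" k, simplified])
qed

text \<open>The off-diagonal terms pair up as \<open>a i j\<close> with
  \<open>a j i\<close>.\<close>

lemma even_symmetric_sum_diff:
  fixes a :: "'a \<Rightarrow> 'a \<Rightarrow> int"
  assumes "finite A" and "\<And>i j. a i j = a j i"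
  shows "even ((\<Sum>i\<in>A. \<Sum>j\<in>A. a i j) - (\<Sum>i\<in>A. a i i))"
  using assms(1)
proof (induction A rule: finite_induct)
  case (insert x A)
  have "(\<Sum>i\<in>A. a i x) = (\<Sum>i\<in>A. a x i)"
    by (rule sum.cong[OF refl assms(2)])
  then have "(\<Sum>i\<in>insert x A. \<Sum>j\<in>insert x A. a i j) - (\<Sum>i\<in>insert x A. a i i) =
      2 * (\<Sum>i\<in>A. a x i) + ((\<Sum>i\<in>A. \<Sum>j\<in>A. a i j) - (\<Sum>i\<in>A. a i i))"
    using insert.hyps by (simp add: sum.distrib)
  then show ?case using insert.IH by simp
qed simp

text \<open>Expanding the iterated ball sum gives \<open>F x\<close>, twice the neighbour sum, and a
  double sum over two flips. That double sum is symmetric, and its diagonal returns to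
  \<open>x\<close> once per coordinate.\<close>

lemma even_ball_sum_ball_sum:
  fixes F :: "'n::finite word \<Rightarrow> int"
  shows "even (ball_sum (ball_sum F) x - (1 + int CARD('n)) * F x)"
proof -
  define D where "D = nbr_sum (nbr_sum F) x"
  have "even ((\<Sum>i\<in>UNIV. \<Sum>j\<in>UNIV. F (x + unit_word i + unit_word j)) -
      (\<Sum>i\<in>UNIV. F (x + unit_word i + unit_word i)))"
    by (rule even_symmetric_sum_diff) (simp_all only: finite ac_simps)
  then have "even (D - int CARD('n) * F x)"
    by (simp add: D_def nbr_sum_def)
  moreover have "ball_sum (ball_sum F) x = F x + 2 * nbr_sum F x + D"
    by (simp add: D_def ball_sum_def nbr_sum_def sum.distrib)
  ultimately show ?thesis
    by (simp add: distrib_right)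
qed

lemma nbr_sum_const [simp]: "nbr_sum (\<lambda>x :: 'n::finite word. c) x = int CARD('n) * c"
  by (simp add: nbr_sum_def)

lemma nbr_sum_translate: "nbr_sum (\<lambda>y. F (a + y)) x = nbr_sum F (a + x)"
  by (simp add: nbr_sum_def add.assoc)

lemma int_Suc_times_binomial:
  "(int k + 1) * int (n choose Suc k) = (int n - int k) * int (n choose k)"
proof (cases "k \<le> n")
  case True
  have "Suc k * (n choose Suc k) = (n - k) * (n choose k)"
    by (metis binomial_absorb_comp binomial_absorption)
  then have "int (Suc k) * int (n choose Suc k) = int (n - k) * int (n choose k)"
    by (metis of_nat_mult)
  then show ?thesis using True by (simp add: of_nat_diff add.commute)
qed (simp add: binomial_eq_0)

lemma ball_sum_const [simp]: "ball_sum (\<lambda>x :: 'n::finite word. c) x = (1 + int CARD('n)) * c"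
  by (simp add: ball_sum_def distrib_right)

lemma ball_sum_diff: "ball_sum (\<lambda>x. F x - G x) x = ball_sum F x - ball_sum G x"
  by (simp add: ball_sum_def nbr_sum_def sum_subtractf)

lemma sum_ball_sum:
  fixes F :: "'n::finite word \<Rightarrow> int"
  shows "(\<Sum>x\<in>UNIV. ball_sum F x) = (1 + int CARD('n)) * (\<Sum>x\<in>UNIV. F x)"
  using sum_ball_sum_mult[of "\<lambda>x. 1" F] by (simp add: sum_distrib_left)

lemma shell_sum_ball_sum_0: "shell_sum (ball_sum F) 0 = shell_sum F 0 + shell_sum F 1"
  unfolding ball_sum_def by (simp only: shell_sum_add shell_sum_nbr_sum_0)

lemma shell_sum_ball_sum_Suc:
  fixes F :: "'n::finite word \<Rightarrow> int"
  shows "shell_sum (ball_sum F) (Suc k) = shell_sum F (Suc k) +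
    (int CARD('n) - int k) * shell_sum F k + (int k + 2) * shell_sum F (k + 2)"
  unfolding ball_sum_def by (simp only: shell_sum_add shell_sum_nbr_sum_Suc)

lemma ball_sum_translate: "ball_sum (\<lambda>y. F (a + y)) x = ball_sum F (a + x)"
  by (simp add: ball_sum_def nbr_sum_translate)

section \<open>Nearly perfect codes: excess and extremal counting\<close>

locale nearly_perfect =
  fixes r :: nat and C :: "'n::finite word set"
  assumes r_ge_2: "r \<ge> 2" and np1cc: "np1cc r C"
begin

definition ind :: "'n word \<Rightarrow> int" where
  "ind x = of_bool (x \<in> C)"

definition excess :: "'n word \<Rightarrow> int" where
  "excess x = ball_sum ind x - 1"

lemma card_index: "CARD('n) = 2 ^ r"
  using np1cc by (simp add: np1cc_def)

lemma even_card_index: "even (int CARD('n))"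
  using r_ge_2 by (simp add: card_index)

lemma sum_ind: "(\<Sum>x\<in>UNIV. ind x) = int (card C)"
  unfolding ind_def by simp

lemma sum_one_words: "(\<Sum>x\<in>(UNIV :: 'n word set). 1) = int CARD('n) * int (card C)"
proof -
  \<comment> \<open>Ensures that the truncated exponent \<open>CARD('n) - r\<close> is a true
    difference.\<close>
  have "r \<le> CARD('n)"
    using less_exp[of r] by (simp add: card_index)
  then have "(2 :: nat) ^ CARD('n) = 2 ^ r * 2 ^ (CARD('n) - r)"
    by (simp flip: power_add)
  moreover have "card C = 2 ^ (CARD('n) - r)"
    using np1cc by (simp add: np1cc_def)
  ultimately have "CARD('n word) = CARD('n) * card C"
    by (simp add: card_bit card_index)
  then show ?thesis by (simp flip: of_nat_mult)
qed

lemma excess_nonneg: "excess x \<ge> 0"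
proof -
  obtain c where c: "c \<in> C" "hamming_dist x c \<le> 1"
    using np1cc by (auto simp: np1cc_def)
  have nonneg: "ind y \<ge> 0" for y by (simp add: ind_def)
  then have nbr: "nbr_sum ind x \<ge> 0"
    by (simp add: nbr_sum_def sum_nonneg)
  show ?thesis
  proof (cases "c = x")
    case True
    then show ?thesis using c nbr by (simp add: excess_def ball_sum_def ind_def)
  next
    case False
    then have "x + c \<noteq> 0"
      by (metis word_add_cancel add.commute add_0)
    then have "hamming_weight (x + c) = 1"
      using c(2) hamming_weight_eq_0[of "x + c"] unfolding hamming_dist_weight by linarith
    then obtain i where "x + c = unit_word i"
      using hamming_weight_eq_1 by blast
    then have "c = x + unit_word i"
      by (metis word_add_cancel add.commute)
    then have "ind (x + unit_word i) = 1"
      using c(1) by (simp add: ind_def)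
    then have "nbr_sum ind x \<ge> 1"
      unfolding nbr_sum_def
      using member_le_sum[of i UNIV "\<lambda>i. ind (x + unit_word i)"] nonneg by simp
    then show ?thesis using nonneg[of x] by (simp add: excess_def ball_sum_def)
  qed
qed

text \<open>As \<open>n\<close> is even, modulo 2 the ball sum is an involution fixing constants;
  apply it to the definition of the excess.\<close>

lemma even_ball_sum_excess: "even (ball_sum excess x - (1 - ind x))"
proof -
  have "ball_sum excess x = ball_sum (ball_sum ind) x - (1 + int CARD('n))"
    unfolding excess_def by (simp add: ball_sum_diff)
  moreover have "even (ball_sum (ball_sum ind) x - (1 + int CARD('n)) * ind x)"
    by (rule even_ball_sum_ball_sum)
  ultimately show ?thesis
    using even_card_index by (auto simp: ind_def)
qed

lemma ball_sum_excess_nonneg: "ball_sum excess x \<ge> 0"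
  by (simp add: ball_sum_def nbr_sum_def sum_nonneg excess_nonneg)

text \<open>Balls have \<open>n + 1\<close> points and there are \<open>n * card C\<close> words, so
  the total is the difference \<open>(n + 1) * card C - n * card C\<close>.\<close>

lemma sum_excess: "(\<Sum>x\<in>UNIV. excess x) = int (card C)"
proof -
  have "(\<Sum>x\<in>UNIV. excess x) = (\<Sum>x\<in>UNIV. ball_sum ind x) - (\<Sum>x\<in>(UNIV :: 'n word set). 1)"
    unfolding excess_def sum_subtractf ..
  then show ?thesis
    unfolding sum_ball_sum sum_one_words sum_ind by (simp add: distrib_right)
qed

lemma ball_sum_excess_ge:
  assumes "x \<notin> C"
  shows "ball_sum excess x \<ge> 1"
proof -
  have "ball_sum excess x \<noteq> 0"
    using even_ball_sum_excess[of x] assms by (auto simp: ind_def)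
  then show ?thesis using ball_sum_excess_nonneg[of x] by linarith
qed

text \<open>
  Double counting \<open>\<Sum>x\<notin>C. S e x = \<Sum>x. (n - e x) e x\<close> leaves no slack, by the size of \<open>C\<close>.
\<close>

lemma excess_tight:
  shows "excess x \<in> {0, 1}" and "x \<notin> C \<Longrightarrow> ball_sum excess x = 1"
proof -
  \<comment> \<open>Two nonnegative slacks: \<open>a\<close> for ball sums above 1 off the code,
    \<open>b\<close> for excess values above 1. Their totals turn out to be negatives of each other,
    so both vanish everywhere.\<close>
  define a where "a x = (1 - ind x) * (ball_sum excess x - 1)" for x
  define b where "b x = excess x * (excess x - 1)" for x
  have a: "a x \<ge> 0" for x
    using ball_sum_excess_ge[of x] by (cases "x \<in> C") (simp_all add: a_def ind_def)
  have b: "b x \<ge> 0" for x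
    using excess_nonneg[of x] by (cases "excess x = 0") (auto simp: b_def)
  have "(\<Sum>x\<in>UNIV. (1 - ind x) * ball_sum excess x)
      = (\<Sum>x\<in>UNIV. ball_sum (\<lambda>x. 1 - ind x) x * excess x)"
    by (rule sum_ball_sum_mult)
  \<comment> \<open>The ball sum of \<open>1 - ind\<close> is \<open>n - excess\<close>, and
    \<open>(n - e) * e = (n - 1) * e - e * (e - 1)\<close>.\<close>
  also have "\<dots> = (\<Sum>x\<in>UNIV. (int CARD('n) - 1) * excess x - b x)"
    by (intro sum.cong refl) (simp add: ball_sum_diff b_def excess_def algebra_simps)
  also have "\<dots> = (int CARD('n) - 1) * int (card C) - (\<Sum>x\<in>UNIV. b x)"
    by (simp add: sum_subtractf sum_excess flip: sum_distrib_left)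
  finally have 1: "(\<Sum>x\<in>UNIV. (1 - ind x) * ball_sum excess x) =
      (int CARD('n) - 1) * int (card C) - (\<Sum>x\<in>UNIV. b x)" .
  have "(\<Sum>x\<in>UNIV. a x) = (\<Sum>x\<in>UNIV. (1 - ind x) * ball_sum excess x) -
      (\<Sum>x\<in>UNIV. 1 - ind x)"
    by (simp only: a_def right_diff_distrib sum_subtractf mult_1_right)
  also have "(\<Sum>x\<in>UNIV. 1 - ind x) = (int CARD('n) - 1) * int (card C)"
    by (simp only: sum_subtractf sum_one_words sum_ind left_diff_distrib mult_1)
  finally have "(\<Sum>x\<in>UNIV. a x) = - (\<Sum>x\<in>UNIV. b x)"
    using 1 by simp
  moreover have "(\<Sum>x\<in>UNIV. a x) \<ge> 0" "(\<Sum>x\<in>UNIV. b x) \<ge> 0"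
    using a b by (auto intro: sum_nonneg)
  ultimately have "(\<Sum>x\<in>UNIV. a x) = 0" "(\<Sum>x\<in>UNIV. b x) = 0"
    by auto
  then have ab: "a x = 0" "b x = 0" for x
    using a b by (auto simp: sum_nonneg_eq_0_iff)
  show "excess x \<in> {0, 1}"
    using ab(2)[of x] by (auto simp: b_def)
  show "x \<notin> C \<Longrightarrow> ball_sum excess x = 1"
    using ab(1)[of x] by (auto simp: a_def ind_def)
qed

text \<open>Otherwise the excess vanishes on the ball around \<open>x\<close>. Shell by shell this
  determines the code up to distance 3 and gives six times the number of codewords at distance 3 as
  \<open>n\<^sup>2\<close>, a power of two not divisible by 3.\<close>

lemma ball_sum_excess_pos:
  assumes "x \<in> C"
  shows "ball_sum excess x \<noteq> 0"
proof
  assume zero: "ball_sum excess x = 0"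
  \<comment> \<open>Translation puts \<open>x\<close> at the origin, so that shells count codewords
    by distance from \<open>x\<close>.\<close>
  define f where "f y = ind (x + y)" for y
  define e where "e y = excess (x + y)" for y
  have ball_f: "ball_sum f = (\<lambda>y. 1 + e y)"
    unfolding f_def e_def excess_def by (auto simp: ball_sum_translate)
  have ball_e: "ball_sum e y = ball_sum excess (x + y)" for y
    unfolding e_def by (rule ball_sum_translate)
  have f_shell: "shell_sum (ball_sum f) k = int (CARD('n) choose k) + shell_sum e k" for k
    unfolding ball_f by (simp only: shell_sum_add shell_sum_1)
  have e_nonneg: "e y \<ge> 0" for y by (simp add: e_def excess_nonneg)
  have f_nonneg: "f y \<ge> 0" for y by (simp add: f_def ind_def)
  have "shell_sum e 0 + shell_sum e 1 = 0"
    using shell_sum_ball_sum_0[of e] zero by (simp add: ball_e)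
  moreover have "shell_sum e 0 \<ge> 0" "shell_sum e 1 \<ge> 0"
    unfolding shell_sum_def by (auto intro: sum_nonneg e_nonneg)
  ultimately have e01: "shell_sum e 0 = 0" "shell_sum e 1 = 0" by auto
  have f0: "shell_sum f 0 = 1"
    using assms by (simp add: f_def ind_def)
  have f1: "shell_sum f 1 = 0"
    using shell_sum_ball_sum_0[of f] f_shell[of 0] e01 f0 by simp
  have f2: "shell_sum f 2 = 0"
    using shell_sum_ball_sum_Suc[of f 0] f_shell[of 1] e01 f0 f1 by (simp add: numeral_2_eq_2)
  have f3: "3 * shell_sum f 3 = int (CARD('n) choose 2) + shell_sum e 2"
    using shell_sum_ball_sum_Suc[of f 1] f_shell[of 2] f1 f2
    by (simp add: numeral_2_eq_2 numeral_3_eq_3)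
  \<comment> \<open>No neighbour of \<open>x\<close> is a codeword, so tightness applies at each of
    them; summing over the first shell yields the excess on the second.\<close>
  have "f y = 0" if "hamming_weight y = 1" for y
    using f1 f_nonneg that unfolding shell_sum_def by (subst (asm) sum_nonneg_eq_0_iff) auto
  then have "ball_sum e y = 1" if "hamming_weight y = 1" for y
    unfolding ball_e using that by (intro excess_tight(2)) (auto simp: f_def ind_def)
  then have "shell_sum (ball_sum e) 1 = shell_sum (\<lambda>y :: 'n word. 1) 1"
    unfolding shell_sum_def by (intro sum.cong) auto
  then have e2: "2 * shell_sum e 2 = int CARD('n)"
    using shell_sum_ball_sum_Suc[of e 0] e01 shell_sum_1[where ?'n = 'n, of 1]
    by (simp add: numeral_2_eq_2)
  have "(1 + 1) * int (CARD('n) choose 2) = (int CARD('n) - 1) * int CARD('n)"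
    using int_Suc_times_binomial[of 1 "CARD('n)"] by (simp add: numeral_2_eq_2)
  then have "3 * (2 * shell_sum f 3) = int CARD('n) * int CARD('n)"
    using f3 e2 by (simp add: left_diff_distrib)
  also have "\<dots> = 2 ^ (2 * r)"
    by (simp add: card_index mult_2 power_add)
  finally have "3 dvd (2 :: int) ^ (2 * r)"
    by (metis dvd_triv_left)
  then have "3 dvd (2 :: int)"
    by (rule prime_dvd_power[rotated]) simp
  then show False by simp
qed

text \<open>On the code the value is even, nonnegative and nonzero, hence at least 2. Its average
  there is exactly 2: by symmetry its total is that of \<open>(1 + e) * e\<close>, which is
  \<open>2 * e\<close> because \<open>e\<close> is 0 or 1.\<close>

lemma ball_sum_excess: "ball_sum excess x = 1 + ind x"
proof (cases "x \<in> C")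
  case True
  define g where "g x = ind x * (ball_sum excess x - 2)" for x
  have ge: "ball_sum excess y \<ge> 2" if "y \<in> C" for y
  proof -
    have "even (ball_sum excess y)"
      using even_ball_sum_excess[of y] that by (simp add: ind_def)
    then show ?thesis
      using ball_sum_excess_pos[OF that] ball_sum_excess_nonneg[of y] by presburger
  qed
  then have g: "g y \<ge> 0" for y
    by (simp add: g_def ind_def)
  have "(\<Sum>x\<in>UNIV. ind x * ball_sum excess x) = (\<Sum>x\<in>UNIV. ball_sum ind x * excess x)"
    by (rule sum_ball_sum_mult)
  also have "\<dots> = (\<Sum>x\<in>UNIV. 2 * excess x)"
  proof (intro sum.cong refl)
    fix x show "ball_sum ind x * excess x = 2 * excess x"
      using excess_tight(1)[of x] by (auto simp: excess_def)
  qed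
  also have "\<dots> = 2 * int (card C)"
    by (simp add: sum_excess flip: sum_distrib_left)
  finally have "(\<Sum>x\<in>UNIV. ind x * ball_sum excess x) = 2 * int (card C)" .
  then have "(\<Sum>x\<in>UNIV. g x) = 0"
    by (simp add: g_def right_diff_distrib sum_subtractf sum_ind flip: sum_distrib_right)
  then have "g x = 0"
    using g by (subst (asm) sum_nonneg_eq_0_iff) auto
  then show ?thesis using True by (simp add: g_def ind_def)
next
  case False
  then show ?thesis using excess_tight(2)[of x] by (simp add: ind_def)
qed

section \<open>Weight distributions of the code and its excess\<close>

lemma shell_sum_ball_sum_ind:
  "shell_sum (ball_sum ind) k = int (CARD('n) choose k) + shell_sum excess k"
proof -
  have "ball_sum ind = (\<lambda>x. 1 + excess x)" by (auto simp: excess_def)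
  then show ?thesis by (simp only: shell_sum_add shell_sum_1)
qed

lemma shell_sum_ball_sum_excess:
  "shell_sum (ball_sum excess) k = int (CARD('n) choose k) + shell_sum ind k"
proof -
  have "ball_sum excess = (\<lambda>x. 1 + ind x)" by (auto simp: ball_sum_excess)
  then show ?thesis by (simp only: shell_sum_add shell_sum_1)
qed

text \<open>The two ball sum equations are interchanged by swapping \<open>ind\<close> and
  \<open>excess\<close>, and they determine every shell from the two before it. Equal values at the
  origin therefore propagate.\<close>

lemma shell_sum_excess_eq:
  assumes "excess 0 = ind 0"
  shows "shell_sum excess k = shell_sum ind k"
proof (induction k rule: less_induct)
  case (less k)
  consider "k = 0" | "k = 1" | j where "k = j + 2"
    by (metis One_nat_def Suc_eq_plus1 add_2_eq_Suc' not0_implies_Suc)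
  then show ?case
  proof cases
    case 1
    then show ?thesis using assms by simp
  next
    case 2
    then show ?thesis
      using shell_sum_ball_sum_0[of ind] shell_sum_ball_sum_0[of excess] assms
      unfolding shell_sum_ball_sum_ind shell_sum_ball_sum_excess by simp
  next
    case 3
    have "shell_sum excess j = shell_sum ind j" "shell_sum excess (Suc j) = shell_sum ind (Suc j)"
      using less 3 by auto
    then have "(int j + 2) * shell_sum excess k = (int j + 2) * shell_sum ind k"
      using shell_sum_ball_sum_Suc[of ind j] shell_sum_ball_sum_Suc[of excess j]
      unfolding shell_sum_ball_sum_ind shell_sum_ball_sum_excess 3 by simp
    then show ?thesis by simp
  qed
qed

section \<open>Low-weight codewords and the hypotheses on types\<close>

lemma weight_count_shell_sum: "int (weight_count C k) = shell_sum ind k"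
proof -
  have "{c \<in> C. hamming_weight c = k} = {x. hamming_weight x = k} \<inter> C" by auto
  then show ?thesis by (simp add: shell_sum_def ind_def weight_count_def)
qed

lemma ind_0: "ind 0 = of_bool (zeroed C)"
  by (simp add: ind_def zeroed_def)

lemma weight_count_1: "int (weight_count C 1) = 1 - ind 0 + excess 0"
  using shell_sum_ball_sum_0[of ind] shell_sum_ball_sum_ind[of 0]
  by (simp add: weight_count_shell_sum)

text \<open>The first-shell equation for \<open>ind\<close>, with the excess on that shell
  eliminated through the ball sum of \<open>excess\<close> at the origin.\<close>

lemma weight_count_2:
  "2 * int (weight_count C 2) = 1 + ind 0 - excess 0 + int CARD('n) * (1 - ind 0) - int (weight_count C 1)"
  using shell_sum_ball_sum_0[of excess] shell_sum_ball_sum_excess[of 0]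
    shell_sum_ball_sum_Suc[of ind 0] shell_sum_ball_sum_ind[of 1]
  by (simp add: weight_count_shell_sum right_diff_distrib numeral_2_eq_2)

lemma weight_count_pos_iff: "weight_count C k > 0 \<longleftrightarrow> (\<exists>c\<in>C. hamming_weight c = k)"
  by (auto simp: weight_count_def card_gt_0_iff)

text \<open>If the excess at the origin were 0, there would be no codeword of weight one and exactly
  one of weight two; the latter is a partner of the zero word at distance 2, which excludes Type
  A.\<close>

lemma excess_0_zeroed:
  assumes "zeroed C" and "type_A C \<or> (\<exists>c\<in>C. hamming_weight c = 1)"
  shows "excess 0 = ind 0"
proof -
  have "excess 0 \<noteq> 0"
  proof
    assume e: "excess 0 = 0"
    then have w1: "weight_count C 1 = 0"
      using weight_count_1 assms(1) by (simp add: ind_0)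
    then have "type_A C"
      using assms(2) weight_count_pos_iff[of 1] by auto
    have "weight_count C 2 > 0"
      using weight_count_2 assms(1) w1 e by (simp add: ind_0)
    then obtain c where c: "c \<in> C" "hamming_weight c = 2"
      using weight_count_pos_iff by blast
    then have "is_partner C 0 c"
      using hamming_weight_eq_0[of c] by (auto simp: is_partner_def hamming_dist_weight)
    then have "hamming_dist 0 c = 1"
      using \<open>type_A C\<close> assms(1) by (auto simp: type_A_def zeroed_def)
    then show False
      using c by (simp add: hamming_dist_weight)
  qed
  then show ?thesis
    using excess_tight(1)[of 0] assms(1) by (auto simp: ind_0)
qed

text \<open>If the excess at the origin were 1, there would be two codewords of weight one. They
  contradict uniqueness, and being partners at distance 2 they also exclude Type A.\<close>

lemma excess_0_non_zeroed:
  assumes "\<not> zeroed C" and "type_A C \<or> (\<exists>!c. c \<in> C \<and> hamming_weight c = 1)"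
  shows "excess 0 = ind 0"
proof -
  have "excess 0 \<noteq> 1"
  proof
    assume "excess 0 = 1"
    then have "card {c \<in> C. hamming_weight c = 1} = 2"
      using weight_count_1 assms(1) by (simp add: ind_0 weight_count_def)
    then obtain c c' where "{c \<in> C. hamming_weight c = 1} = {c, c'}" and "c \<noteq> c'"
      unfolding card_2_iff by blast
    then have c: "c \<in> C" "hamming_weight c = 1" "c' \<in> C" "hamming_weight c' = 1" "c \<noteq> c'"
      by blast+
    then have "type_A C" using assms(2) by blast
    obtain i j where ij: "c = unit_word i" "c' = unit_word j"
      using c hamming_weight_eq_1 by blast
    then have d: "hamming_dist c c' = 2"
      using c(5) hamming_weight_add_unit[of c j]
      by (simp add: hamming_dist_weight unit_word_nth)
    then have "is_partner C c c'"
      using c by (auto simp: is_partner_def)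
    then show False
      using \<open>type_A C\<close> c(1) d by (auto simp: type_A_def)
  qed
  then show ?thesis
    using excess_tight(1)[of 0] assms(1) by (auto simp: ind_0)
qed

end

section \<open>Closed form of the weight distribution\<close>

text \<open>The coefficient of \<open>x ^ k\<close> in \<open>(1 - x\<^sup>2) ^ m\<close>, which is the Krawtchouk polynomial
  of degree \<open>k\<close> for length \<open>2 * m\<close> at \<open>m\<close>.\<close>

definition middle_krawtchouk :: "nat \<Rightarrow> nat \<Rightarrow> int" where
  "middle_krawtchouk m k = (if even k then (- 1) ^ (k div 2) * int (m choose (k div 2)) else 0)"

text \<open>Compares coefficients in \<open>(1 - x\<^sup>2) * p' = - 2 * m * x * p\<close> for
  \<open>p = (1 - x\<^sup>2) ^ m\<close>.\<close>

lemma middle_krawtchouk_rec: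
  "(int k + 2) * middle_krawtchouk m (k + 2) = - (2 * int m - int k) * middle_krawtchouk m k"
proof (cases "even k")
  case True
  then obtain j where j: "k = 2 * j" by blast
  have "(int j + 1) * int (m choose Suc j) = (int m - int j) * int (m choose j)"
    by (rule int_Suc_times_binomial)
  then have "2 * (- 1) ^ j * ((int j + 1) * int (m choose Suc j)) =
      2 * (- 1) ^ j * ((int m - int j) * int (m choose j))"
    by simp
  then show ?thesis
    by (simp add: middle_krawtchouk_def j algebra_simps)
qed (simp add: middle_krawtchouk_def)

text \<open>For even \<open>i\<close> the two terms carry the same sign, and Pascal's rule merges
  their binomials.\<close>

lemma Delta_pair:
  assumes "even i" "i \<noteq> 0"
  shows "Delta \<nu> (i - 1) + Delta \<nu> i = real_of_int (middle_krawtchouk (Suc \<nu>) i)"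
proof -
  obtain j where i: "i = 2 * Suc j"
    using assms by (metis dvdE mult_0_right not0_implies_Suc)
  have "Suc (2 * j) div 2 = j" "2 * Suc j div 2 = Suc j" by simp_all
  moreover have "Suc (2 * j) mod 4 \<in> {0, 3} \<longleftrightarrow> odd j" "2 * Suc j mod 4 \<in> {0, 3} \<longleftrightarrow> odd j"
    by simp_all presburger+
  ultimately show ?thesis
    by (auto simp: Delta_def middle_krawtchouk_def i)
qed

text \<open>Since code and excess share their distribution, the middle shell cancels from the
  recurrence. The binomial over \<open>n\<close> is a particular solution,
  \<open>middle_krawtchouk\<close> solves the homogeneous equation, and \<open>k = 0\<close> fixes
  its coefficient.\<close>

lemma (in nearly_perfect) shell_sum_ind_formula:
  assumes "excess 0 = ind 0" and m: "CARD('n) = 2 * m"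
  shows "int CARD('n) * shell_sum ind k =
    int (CARD('n) choose k) + (int CARD('n) * ind 0 - 1) * middle_krawtchouk m k"
proof (induction k rule: less_induct)
  case (less k)
  define n where "n = int CARD('n)"
  consider "k = 0" | "k = 1" | j where "k = j + 2"
    by (metis One_nat_def Suc_eq_plus1 add_2_eq_Suc' not0_implies_Suc)
  then show ?case
  proof cases
    case 1
    then show ?thesis by (simp add: middle_krawtchouk_def)
  next
    case 2
    then show ?thesis
      using shell_sum_ball_sum_0[of ind] assms
      unfolding shell_sum_ball_sum_ind by (simp add: middle_krawtchouk_def)
  next
    case 3
    let ?b = "\<lambda>i. int (CARD('n) choose i)"
    have IH: "n * shell_sum ind j = ?b j + (n * ind 0 - 1) * middle_krawtchouk m j"
      using less 3 by (simp add: n_def)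
    have "(n - int j) * shell_sum ind j + (int j + 2) * shell_sum ind k = ?b (Suc j)"
      using shell_sum_ball_sum_Suc[of ind j]
      unfolding shell_sum_ball_sum_ind shell_sum_excess_eq[OF assms(1)] 3 n_def by simp
    then have "(n - int j) * (n * shell_sum ind j) + (int j + 2) * (n * shell_sum ind k) = n * ?b (Suc j)"
      by (metis distrib_left mult.left_commute)
    \<comment> \<open>In this identity and the next, \<open>?b (Suc j)\<close> has coefficients
      \<open>int j + 1\<close> and \<open>n - int j - 1\<close>, which add up to
      \<open>n\<close>.\<close>
    moreover have "(int j + 1) * ?b (Suc j) = (n - int j) * ?b j"
      unfolding n_def by (rule int_Suc_times_binomial)
    moreover have "(int j + 2) * ?b k = (n - int j - 1) * ?b (Suc j)"
      using int_Suc_times_binomial[of "Suc j" "CARD('n)"] by (simp add: n_def 3 algebra_simps)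
    moreover have "(int j + 2) * middle_krawtchouk m k = - (n - int j) * middle_krawtchouk m j"
      using middle_krawtchouk_rec[of j m] by (simp add: n_def m 3)
    ultimately have "(int j + 2) * (n * shell_sum ind k) =
        (int j + 2) * (?b k + (n * ind 0 - 1) * middle_krawtchouk m k)"
      unfolding IH by algebra
    then show ?thesis
      by (simp add: n_def)
  qed
qed

section \<open>Translation to \<open>alpha\<close> and \<open>beta\<close>, and the final case
  split\<close>

lemma alpha_pair:
  assumes "n > 0" "i > 0"
  shows "alpha n \<nu> i + alpha n \<nu> (i - 1) =
    (real (n choose i) + (real n - 1) * (Delta \<nu> (i - 1) + Delta \<nu> i)) / real n"
  unfolding alpha_def choose_reduce_nat[OF assms]
  by (simp add: algebra_simps flip: add_divide_distrib diff_divide_distrib)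

lemma beta_pair:
  assumes "n > 0" "i > 0"
  shows "beta n \<nu> i + beta n \<nu> (i - 1) =
    (real (n choose i) - (Delta \<nu> (i - 1) + Delta \<nu> i)) / real n"
  unfolding beta_def choose_reduce_nat[OF assms]
  by (simp add: algebra_simps flip: add_divide_distrib diff_divide_distrib)

theorem theorem4:
  fixes C :: "'n::finite word set" and r n \<nu> :: nat
  assumes "r \<ge> 2" and "n = 2 ^ r" and "\<nu> = 2 ^ (r - 1) - 1"
    and "np1cc r C"
  shows
    "(zeroed C \<and> (type_A C \<or> (type_C C \<and> (\<exists>c\<in>C. hamming_weight c = 1))) \<longrightarrow>
        weight_count C 0 = 1 \<and> weight_count C n = 1 \<and>
        (\<forall>i. even i \<and> i \<noteq> 0 \<and> i \<noteq> n \<longrightarrow>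
           real (weight_count C i) = alpha n \<nu> i + alpha n \<nu> (i - 1) \<and>
           alpha n \<nu> i + alpha n \<nu> (i - 1) =
             (real (n choose i) + (real n - 1) * (Delta \<nu> (i - 1) + Delta \<nu> i)) / real n) \<and>
        (\<forall>i. odd i \<and> 1 \<le> i \<and> i \<le> n - 1 \<longrightarrow>
           real (weight_count C i) = 1 / real n * real (n choose i)))
     \<and>
     (\<not> zeroed C \<and> (type_A C \<or> ((type_B C \<or> type_C C) \<and> (\<exists>!c. c \<in> C \<and> hamming_weight c = 1))) \<longrightarrow>
        weight_count C 0 = 0 \<and> weight_count C n = 0 \<and>
        (\<forall>i. even i \<and> 1 < i \<and> i < n - 1 \<longrightarrow>
           real (weight_count C i) = beta n \<nu> i + beta n \<nu> (i - 1) \<and>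
           beta n \<nu> i + beta n \<nu> (i - 1) =
             (real (n choose i) - (Delta \<nu> (i - 1) + Delta \<nu> i)) / real n) \<and>
        (\<forall>i. odd i \<and> 1 \<le> i \<and> i \<le> n - 1 \<longrightarrow>
           real (weight_count C i) = 1 / real n * real (n choose i)))"
proof -
  interpret nearly_perfect r C
    using assms by unfold_locales
  have n: "CARD('n) = n"
    using card_index assms(2) by simp
  obtain s where r: "r = Suc (Suc s)"
    using assms(1) by (metis add_2_eq_Suc le_Suc_ex)
  have n\<nu>: "n = 2 * Suc \<nu>" and \<nu>: "even (Suc \<nu>)"
    by (simp_all add: assms(2,3) r)
  then have "n > 0" by simp
  \<comment> \<open>One formula serves both parts: the coefficient is \<open>n - 1\<close> for
    zeroed codes, as in \<open>alpha\<close>, and \<open>- 1\<close> otherwise, as in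
    \<open>beta\<close>.\<close>
  have count: "real (weight_count C k) =
      (real (n choose k) + (real n * of_bool (zeroed C) - 1) *
        real_of_int (middle_krawtchouk (Suc \<nu>) k)) / real n"
    if "excess 0 = ind 0" for k
  proof -
    have "int n * int (weight_count C k) =
        int (n choose k) + (int n * of_bool (zeroed C) - 1) * middle_krawtchouk (Suc \<nu>) k"
      using shell_sum_ind_formula[of "Suc \<nu>" k] that n n\<nu>
      by (simp only: weight_count_shell_sum ind_0)
    then have "real_of_int (int n * int (weight_count C k)) = real_of_int
        (int (n choose k) + (int n * of_bool (zeroed C) - 1) * middle_krawtchouk (Suc \<nu>) k)"
      by (rule arg_cong)
    then have "real n * real (weight_count C k) =
        real (n choose k) + (real n * of_bool (zeroed C) - 1) * real_of_int (middle_krawtchouk (Suc \<nu>) k)"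
      by simp
    then show ?thesis
      using \<open>n > 0\<close> by (simp add: eq_divide_eq mult.commute)
  qed
  have odd_count: "real (weight_count C k) = 1 / real n * real (n choose k)"
    if "excess 0 = ind 0" "odd k" for k
    using count[OF that(1), of k] that(2) by (simp add: middle_krawtchouk_def)
  have count_0: "weight_count C 0 = of_bool (zeroed C)"
    using weight_count_shell_sum[of 0] by (cases "zeroed C") (simp_all add: ind_0)
  \<comment> \<open>The sign at weight \<open>n\<close> is that of \<open>(- 1) ^ Suc \<nu>\<close>,
    positive because \<open>Suc \<nu> = 2 ^ (r - 1)\<close> with \<open>r \<ge> 2\<close>.\<close>
  have "middle_krawtchouk (Suc \<nu>) n = 1"
    using \<nu> by (simp add: middle_krawtchouk_def n\<nu>)
  then have count_n: "weight_count C n = of_bool (zeroed C)" if "excess 0 = ind 0"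
    using count[OF that, of n] \<open>n > 0\<close> by (cases "zeroed C") simp_all
  show ?thesis
  proof ((rule conjI; rule impI), goal_cases)
    case 1
    then have z: "zeroed C" and e: "excess 0 = ind 0"
      using excess_0_zeroed by blast+
    \<comment> \<open>The formula for \<open>count\<close> has no upper bound on the weight, so even
      \<open>i\<close> beyond \<open>n\<close> are covered as well.\<close>
    have "real (weight_count C i) = alpha n \<nu> i + alpha n \<nu> (i - 1)" if "even i" "i \<noteq> 0" for i
      using count[OF e, of i] z that \<open>n > 0\<close> by (simp add: alpha_pair Delta_pair del: One_nat_def)
    then show ?case
      using z e count_0 count_n odd_count alpha_pair[OF \<open>n > 0\<close>] by simp
  next
    case 2
    then have z: "\<not> zeroed C" and e: "excess 0 = ind 0"
      using excess_0_non_zeroed by blast+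
    have "real (weight_count C i) = beta n \<nu> i + beta n \<nu> (i - 1)" if "even i" "i \<noteq> 0" for i
      using count[OF e, of i] z that \<open>n > 0\<close> by (simp add: beta_pair Delta_pair del: One_nat_def)
    then show ?case
      using z e count_0 count_n odd_count beta_pair[OF \<open>n > 0\<close>] by simp
  qed
qed

end
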